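(* Let $X$ be a Banach space and let $\mathcal{U}=\{U(t,s)\}_{t\ge s\ge 0}$ be a nonuniform exponentially bounded evolution family on $X$. Then $\mathcal{U}$ is nonuniformly stable if and only if there exists $\alpha\in\mathcal{A}(\mathcal{U})$ such that $$\ker A_{\alpha,\tau}=\Phi(\tau)\,\mathcal{C}_b(\mathcal{U},\alpha)\quad\text{for every }\tau\ge 0.$$
   Context: $X$ is a Banach space, $\mathcal{L}(X)$ is the algebra of bounded linear operators on $X$, and $\mathbb{R}_+=[0,\infty)$. $C(\mathbb{R}_+,X)$ is the space of all continuous functions $u:\mathbb{R}_+\to X$. An evolution family is a family $\mathcal{U}=\{U(t,s)\}_{t\ge s\ge 0}$ in $\mathcal{L}(X)$ such that $U(t,t)=\mathrm{Id}$ for $t\ge 0$; $U(t,\tau)U(\tau,s)=U(t,s)$ for $t\ge\tau\ge s\ge 0$; and for each $x\in X$ the map $(t,s)\mapsto U(t,s)x$ is continuous on $\{(t,s)\in\mathbb{R}_+^2: t\ge s\}$. A number $\alpha\in\mathbb{R}$ is an admissible exponent for $\mathcal{U}$ if there is a continuous function $M:\mathbb{R}_+\to(0,\infty)$ with $\|U(t,s)\|\le M(s)e^{\alpha(t-s)}$ for all $t\ge s\ge 0$. $\mathcal{A}(\mathcal{U})$ is the set of all admissible exponents. $\mathcal{U}$ is nonuniform exponentially bounded if $\mathcal{A}(\mathcal{U})\ne\emptyset$ and nonuniformly stable if $0\in\mathcal{A}(\mathcal{U})$. For $\alpha\in\mathcal{A}(\mathcal{U})$, $t\ge 0$, $u\in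 C(\mathbb{R}_+,X)$, set $\varphi_\alpha(t,u)=\sup_{\tau\ge t}e^{-\alpha(\tau-t)}\|U(\tau,t)u(t)\|$, and let $\mathcal{C}_b(\mathcal{U},\alpha)=\{u\in C(\mathbb{R}_+,X):\sup_{t\ge 0}\varphi_\alpha(t,u)<\infty\}$, a Banach space with norm $\|u\|_\alpha=\sup_{t\ge 0}\varphi_\alpha(t,u)$. For $t\ge 0$ the operator $\Phi(t):C(\mathbb{R}_+,X)\to C(\mathbb{R}_+,X)$ is defined by $(\Phi(t)u)(\xi)=U(\xi,t)u(t)$ for $\xi\ge t$ and $(\Phi(t)u)(\xi)=u(\xi)$ for $0\le\xi<t$. For $\alpha\in\mathcal{A}(\mathcal{U})$ and $\tau\ge 0$, the operator $A_{\alpha,\tau}:D(A_{\alpha,\tau})\subset\mathcal{C}_b(\mathcal{U},\alpha)\to\mathcal{C}_b(\mathcal{U},\alpha)$ is defined as follows: $D(A_{\alpha,\tau})$ is the set of all $u\in\mathcal{C}_b(\mathcal{U},\alpha)$ for which there exists $f\in\mathcal{C}_b(\mathcal{U},\alpha)$ with $f(t)=0$ for all $t\in[0,\tau)$ and $$u(t)=U(t,s)u(s)+\int_s^t U(t,\xi)f(\xi)\,d\xi\quad\text{for all } t\ge s\ge\tau,$$ and then $A_{\alpha,\tau}u=f$ (this $f$ is uniquely determined by $u$, so the operator is well defined). $\ker A_{\alpha,\tau}=\{u\in D(A_{\alpha,\tau}):A_{\alpha,\tau}u=0\}$. *)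

theory Defs
  imports "HOL-Analysis.Analysis"
begin

text \<open>
  Two-parameter families are total functions \<open>U :: real \<Rightarrow> real \<Rightarrow> 'a \<Rightarrow>\<^sub>L 'a\<close>;
  only the values \<open>U t s\<close> with \<open>t \<ge> s \<ge> 0\<close> are ever constrained or used.
\<close>

definition evolution_family :: "(real \<Rightarrow> real \<Rightarrow> 'a::banach \<Rightarrow>\<^sub>L 'a) \<Rightarrow> bool" where
  "evolution_family U \<longleftrightarrow>
     (\<forall>t\<ge>0. U t t = id_blinfun) \<and>
     (\<forall>t r s. t \<ge> r \<and> r \<ge> s \<and> s \<ge> 0 \<longrightarrow> U t r o\<^sub>L U r s = U t s) \<and>
     (\<forall>x. continuous_on {(t, s). t \<ge> s \<and> s \<ge> 0} (\<lambda>(t, s). blinfun_apply (U t s) x))"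

definition admissible_exponents :: "(real \<Rightarrow> real \<Rightarrow> 'a::banach \<Rightarrow>\<^sub>L 'a) \<Rightarrow> real set" where
  "admissible_exponents U =
     {\<alpha>. \<exists>M :: real \<Rightarrow> real. continuous_on {0..} M \<and> (\<forall>s\<ge>0. M s > 0) \<and>
          (\<forall>t s. t \<ge> s \<and> s \<ge> 0 \<longrightarrow> norm (U t s) \<le> M s * exp (\<alpha> * (t - s)))}"

definition nonuniform_exponentially_bounded ::
    "(real \<Rightarrow> real \<Rightarrow> 'a::banach \<Rightarrow>\<^sub>L 'a) \<Rightarrow> bool" where
  "nonuniform_exponentially_bounded U \<longleftrightarrow> admissible_exponents U \<noteq> {}"

definition nonuniformly_stable :: "(real \<Rightarrow> real \<Rightarrow> 'a::banach \<Rightarrow>\<^sub>L 'a) \<Rightarrow> bool" where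
  "nonuniformly_stable U \<longleftrightarrow> 0 \<in> admissible_exponents U"

text \<open>
  A function on \<open>[0,\<infinity>)\<close> is represented by its extension by zero to all of
  \<open>real\<close>. Each function on \<open>[0,\<infinity>)\<close> thus has exactly one representative, so that
  equality of sets of such functions has its usual meaning, and the zero function is
  \<open>\<lambda>_. 0\<close>.
\<close>

definition C_Rplus :: "(real \<Rightarrow> 'a::banach) set" where
  "C_Rplus = {u. continuous_on {0..} u \<and> (\<forall>t<0. u t = 0)}"

text \<open>
  For admissible \<open>\<alpha>\<close>, \<open>t \<ge> 0\<close>, the set whose supremum is taken is nonempty and bounded above
  (by \<open>M t * norm (u t)\<close>), so the real-valued supremum is the true one.
\<close>

definition phi ::
    "(real \<Rightarrow> real \<Rightarrow> 'a::banach \<Rightarrow>\<^sub>L 'a) \<Rightarrow> real \<Rightarrow> real \<Rightarrow> (real \<Rightarrow> 'a) \<Rightarrow> real" where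
  "phi U \<alpha> t u = (SUP r\<in>{t..}. exp (- \<alpha> * (r - t)) * norm (blinfun_apply (U r t) (u t)))"

definition Cb :: "(real \<Rightarrow> real \<Rightarrow> 'a::banach \<Rightarrow>\<^sub>L 'a) \<Rightarrow> real \<Rightarrow> (real \<Rightarrow> 'a) set" where
  "Cb U \<alpha> = {u \<in> C_Rplus. bdd_above ((\<lambda>t. phi U \<alpha> t u) ` {0..})}"

definition Phi ::
    "(real \<Rightarrow> real \<Rightarrow> 'a::banach \<Rightarrow>\<^sub>L 'a) \<Rightarrow> real \<Rightarrow> (real \<Rightarrow> 'a) \<Rightarrow> real \<Rightarrow> 'a" where
  "Phi U t u = (\<lambda>\<xi>. if \<xi> \<ge> t then blinfun_apply (U \<xi> t) (u t) else u \<xi>)"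

definition A_graph ::
    "(real \<Rightarrow> real \<Rightarrow> 'a::banach \<Rightarrow>\<^sub>L 'a) \<Rightarrow> real \<Rightarrow> real \<Rightarrow> (real \<Rightarrow> 'a) \<Rightarrow> (real \<Rightarrow> 'a) \<Rightarrow> bool"
  where
  "A_graph U \<alpha> \<tau> u f \<longleftrightarrow>
     u \<in> Cb U \<alpha> \<and> f \<in> Cb U \<alpha> \<and> (\<forall>t\<in>{0..<\<tau>}. f t = 0) \<and>
     (\<forall>t s. t \<ge> s \<and> s \<ge> \<tau> \<longrightarrow>
        u t = blinfun_apply (U t s) (u s) + integral {s..t} (\<lambda>\<xi>. blinfun_apply (U t \<xi>) (f \<xi>)))"

definition A_dom ::
    "(real \<Rightarrow> real \<Rightarrow> 'a::banach \<Rightarrow>\<^sub>L 'a) \<Rightarrow> real \<Rightarrow> real \<Rightarrow> (real \<Rightarrow> 'a) set" where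
  "A_dom U \<alpha> \<tau> = {u. \<exists>f. A_graph U \<alpha> \<tau> u f}"

definition A_op ::
    "(real \<Rightarrow> real \<Rightarrow> 'a::banach \<Rightarrow>\<^sub>L 'a) \<Rightarrow> real \<Rightarrow> real \<Rightarrow> (real \<Rightarrow> 'a) \<Rightarrow> (real \<Rightarrow> 'a)" where
  "A_op U \<alpha> \<tau> u = (THE f. A_graph U \<alpha> \<tau> u f)"

definition A_ker ::
    "(real \<Rightarrow> real \<Rightarrow> 'a::banach \<Rightarrow>\<^sub>L 'a) \<Rightarrow> real \<Rightarrow> real \<Rightarrow> (real \<Rightarrow> 'a) set" where
  "A_ker U \<alpha> \<tau> = {u \<in> A_dom U \<alpha> \<tau>. A_op U \<alpha> \<tau> u = (\<lambda>_. 0)}"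

lemma evolution_family_continuous_apply:
  fixes U :: "real \<Rightarrow> real \<Rightarrow> 'a::banach \<Rightarrow>\<^sub>L 'a"
  assumes ev: "evolution_family U" and \<alpha>: "\<alpha> \<in> admissible_exponents U"
    and h: "continuous_on {0..} h" and s: "0 \<le> s"
  shows "continuous_on {s..t} (\<lambda>\<xi>. blinfun_apply (U t \<xi>) (h \<xi>))"
proof -
  obtain M where M: "continuous_on {0..} M"
    and Mb: "\<And>t s. \<lbrakk>t \<ge> s; s \<ge> 0\<rbrakk> \<Longrightarrow> norm (U t s) \<le> M s * exp (\<alpha> * (t - s))"
    using \<alpha> unfolding admissible_exponents_def by blast
  have cont: "continuous_on {s..t} (\<lambda>\<xi>. blinfun_apply (U t \<xi>) x)" for x
  proof -
    have "continuous_on {(t, s). t \<ge> s \<and> s \<ge> 0} (\<lambda>(t, s). blinfun_apply (U t s) x)"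
      using ev unfolding evolution_family_def by blast
    moreover have "continuous_on {s..t} (\<lambda>\<xi>. (t, \<xi>))"
      by (intro continuous_intros)
    ultimately have "continuous_on {s..t} ((\<lambda>(t, s). blinfun_apply (U t s) x) \<circ> (\<lambda>\<xi>. (t, \<xi>)))"
      using s by (intro continuous_on_compose) (auto elim!: continuous_on_subset)
    then show ?thesis by (simp add: o_def)
  qed
  have hc: "continuous_on {s..t} h" and Mc: "continuous_on {s..t} (\<lambda>x. M x * exp (\<alpha> * (t - x)))"
    using s by (auto intro!: continuous_intros continuous_on_subset[OF h] continuous_on_subset[OF M])
  show ?thesis
    unfolding continuous_on_def
  proof
    fix a assume a: "a \<in> {s..t}"
    let ?F = "at a within {s..t}"
    let ?m = "\<lambda>x. M x * exp (\<alpha> * (t - x))"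
    have 1: "((\<lambda>\<xi>. blinfun_apply (U t \<xi>) (h a)) \<longlongrightarrow> blinfun_apply (U t a) (h a)) ?F"
      using cont a unfolding continuous_on_def by blast
    have "(h \<longlongrightarrow> h a) ?F" and mt: "(?m \<longlongrightarrow> ?m a) ?F"
      using hc Mc a unfolding continuous_on_def by blast+
    then have "((\<lambda>\<xi>. norm (h \<xi> - h a)) \<longlongrightarrow> norm (h a - h a)) ?F"
      by (intro tendsto_norm tendsto_diff tendsto_const)
    then have "((\<lambda>\<xi>. ?m \<xi> * norm (h \<xi> - h a)) \<longlongrightarrow> ?m a * norm (h a - h a)) ?F"
      by (rule tendsto_mult[OF mt])
    then have 2: "((\<lambda>\<xi>. ?m \<xi> * norm (h \<xi> - h a)) \<longlongrightarrow> 0) ?F" by simp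
    have "eventually (\<lambda>\<xi>. norm (blinfun_apply (U t \<xi>) (h \<xi> - h a)) \<le> ?m \<xi> * norm (h \<xi> - h a)) ?F"
      unfolding eventually_at_filter
    proof (intro always_eventually allI impI)
      fix \<xi> assume "\<xi> \<in> {s..t}"
      then have "norm (U t \<xi>) \<le> ?m \<xi>" using s by (intro Mb) auto
      then show "norm (blinfun_apply (U t \<xi>) (h \<xi> - h a)) \<le> ?m \<xi> * norm (h \<xi> - h a)"
        by (meson norm_blinfun mult_right_mono norm_ge_zero order_trans)
    qed
    then have 3: "((\<lambda>\<xi>. blinfun_apply (U t \<xi>) (h \<xi> - h a)) \<longlongrightarrow> 0) ?F"
      using 2 by (rule Lim_null_comparison)
    show "((\<lambda>\<xi>. blinfun_apply (U t \<xi>) (h \<xi>)) \<longlongrightarrow> blinfun_apply (U t a) (h a)) ?F"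
      using tendsto_add[OF 1 3] by (simp add: blinfun.diff_right)
  qed
qed

text \<open>The value of \<open>A\<^bsub>\<alpha>,\<tau>\<^esub>\<close> is unique, so the \<open>THE\<close> in \<open>A_op\<close> is well defined.\<close>

lemma A_graph_unique:
  fixes U :: "real \<Rightarrow> real \<Rightarrow> 'a::banach \<Rightarrow>\<^sub>L 'a"
  assumes ev: "evolution_family U" and \<alpha>: "\<alpha> \<in> admissible_exponents U" and \<tau>: "0 \<le> \<tau>"
    and f: "A_graph U \<alpha> \<tau> u f" and g: "A_graph U \<alpha> \<tau> u g"
  shows "f = g"
proof -
  define h where "h = (\<lambda>t. f t - g t)"
  have fc: "continuous_on {0..} f" and gc: "continuous_on {0..} g"
    using f g unfolding A_graph_def Cb_def C_Rplus_def by auto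
  have hc: "continuous_on {0..} h"
    unfolding h_def by (intro continuous_intros fc gc)
  have pos: "h t = 0" if t: "t > \<tau>" for t
  proof -
    let ?k = "\<lambda>\<xi>. blinfun_apply (U t \<xi>) (h \<xi>)"
    have kc: "continuous_on {\<tau>..t} ?k"
      by (rule evolution_family_continuous_apply[OF ev \<alpha> hc \<tau>])
    have zero: "integral {s..t} ?k = 0" if s: "s \<in> {\<tau>..t}" for s
    proof -
      have "(\<lambda>\<xi>. blinfun_apply (U t \<xi>) (f \<xi>)) integrable_on {s..t}"
           "(\<lambda>\<xi>. blinfun_apply (U t \<xi>) (g \<xi>)) integrable_on {s..t}"
        using s \<tau> by (auto intro!: integrable_continuous_real
            evolution_family_continuous_apply[OF ev \<alpha>] fc gc)
      then have "integral {s..t} ?k = integral {s..t} (\<lambda>\<xi>. blinfun_apply (U t \<xi>) (f \<xi>))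
          - integral {s..t} (\<lambda>\<xi>. blinfun_apply (U t \<xi>) (g \<xi>))"
        unfolding h_def blinfun.diff_right by (rule integral_diff)
      also have "\<dots> = 0"
      proof -
        have "u t = blinfun_apply (U t s) (u s) + integral {s..t} (\<lambda>\<xi>. blinfun_apply (U t \<xi>) (f \<xi>))"
             "u t = blinfun_apply (U t s) (u s) + integral {s..t} (\<lambda>\<xi>. blinfun_apply (U t \<xi>) (g \<xi>))"
          using f g s unfolding A_graph_def by auto
        then show ?thesis by (metis add_left_cancel diff_self)
      qed
      finally show ?thesis .
    qed
    have d: "((\<lambda>x. integral {x..t} ?k) has_vector_derivative - ?k t) (at t within {\<tau>..t})"
      using integral_has_vector_derivative'[OF kc, of t] t by simp
    have "((\<lambda>x. 0) has_vector_derivative - ?k t) (at t within {\<tau>..t})"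
      by (rule has_vector_derivative_transform[OF _ _ d]) (use t zero in auto)
    moreover have "((\<lambda>x. 0::'a) has_vector_derivative 0) (at t within {\<tau>..t})"
      by simp
    ultimately have "- ?k t = 0"
      using vector_derivative_unique_within_closed_interval[of \<tau> t t "\<lambda>x. 0::'a" "- ?k t" 0] t
      by (metis atLeastAtMost_iff box_real(2) less_imp_le order_refl)
    moreover have "U t t = id_blinfun"
      using ev t \<tau> unfolding evolution_family_def by auto
    ultimately show "h t = 0" by simp
  qed
  have at_tau: "h \<tau> = 0"
  proof -
    have "(h \<longlongrightarrow> h \<tau>) (at \<tau> within {0..})"
      using hc \<tau> unfolding continuous_on_def by auto
    then have "(h \<longlongrightarrow> h \<tau>) (at_right \<tau>)"
      by (rule tendsto_within_subset) (use \<tau> in auto)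
    moreover have "(h \<longlongrightarrow> 0) (at_right \<tau>)"
      by (rule tendsto_eventually) (auto simp: eventually_at_filter pos)
    ultimately show ?thesis
      by (rule tendsto_unique[rotated]) simp
  qed
  have "h t = 0" for t
  proof -
    consider "t < 0" | "0 \<le> t" "t < \<tau>" | "t = \<tau>" | "t > \<tau>" by linarith
    then show ?thesis
      by cases (use f g pos at_tau in \<open>auto simp: h_def A_graph_def Cb_def C_Rplus_def\<close>)
  qed
  then show ?thesis by (auto simp: h_def)
qed

end

theory Submission
  imports Defs
begin

text \<open>
  The kernel of \<open>A\<^bsub>\<alpha>,\<tau>\<^esub>\<close> consists of the \<open>u\<close> in \<open>Cb U \<alpha>\<close> that are orbits from time \<open>\<tau>\<close> on, and
  these are fixed by \<open>Phi U \<tau>\<close>. So the kernel condition says exactly that \<open>Phi U \<tau>\<close> maps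
  \<open>Cb U \<alpha>\<close> into itself, which is clear for \<open>\<alpha> = 0\<close>. Conversely, through each point \<open>(\<tau>, x)\<close>
  passes a compactly supported \<open>u\<close> in \<open>Cb U \<alpha>\<close>, so invariance makes all orbits bounded. The uniform
  boundedness principle then bounds \<open>U t n\<close> over \<open>t \<ge> n\<close> for each natural \<open>n\<close>, and
  the bounds at integer times are interpolated to a continuous one.
\<close>

section \<open>Weighted orbit suprema and the kernel of \<open>A_op\<close>\<close>

lemma weighted_norm_apply_le:
  assumes "norm T \<le> m * exp c"
  shows "exp (- c) * norm (blinfun_apply T x) \<le> m * norm x"
proof -
  have "norm (blinfun_apply T x) \<le> m * exp c * norm x"
    using norm_blinfun[of T x] mult_right_mono[OF assms norm_ge_zero[of x]] by linarith
  then have "exp (- c) * norm (blinfun_apply T x) \<le> exp (- c) * (m * exp c * norm x)"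
    by (rule mult_left_mono) simp
  also have "\<dots> = m * norm x" by (simp add: exp_minus)
  finally show ?thesis .
qed

text \<open>The real-valued \<open>SUP\<close> in \<open>phi\<close> is meaningful only for bounded
  sets; admissibility supplies the bound \<open>M t * norm (u t)\<close>, uniform in
  \<open>r\<close>.\<close>

lemma phi_bdd_above:
  assumes "\<alpha> \<in> admissible_exponents U" "0 \<le> t"
  shows "bdd_above ((\<lambda>r. exp (- \<alpha> * (r - t)) * norm (blinfun_apply (U r t) (u t))) ` {t..})"
proof -
  obtain M where M: "\<And>t s. \<lbrakk>t \<ge> s; s \<ge> 0\<rbrakk> \<Longrightarrow> norm (U t s) \<le> M s * exp (\<alpha> * (t - s))"
    using assms unfolding admissible_exponents_def by blast
  have "exp (- \<alpha> * (r - t)) * norm (blinfun_apply (U r t) (u t)) \<le> M t * norm (u t)" if "t \<le> r" for r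
    using weighted_norm_apply_le[OF M[OF that assms(2)]] by simp
  then show ?thesis by (auto intro!: bdd_aboveI2)
qed

lemma phi_upper:
  assumes "\<alpha> \<in> admissible_exponents U" "0 \<le> t" "t \<le> r"
  shows "exp (- \<alpha> * (r - t)) * norm (blinfun_apply (U r t) (u t)) \<le> phi U \<alpha> t u"
  unfolding phi_def using assms by (intro cSUP_upper phi_bdd_above) auto

lemma phi_least:
  assumes "\<And>r. t \<le> r \<Longrightarrow> exp (- \<alpha> * (r - t)) * norm (blinfun_apply (U r t) (u t)) \<le> B"
  shows "phi U \<alpha> t u \<le> B"
  unfolding phi_def using assms by (intro cSUP_least) auto

text \<open>The term \<open>r = t\<close> of the supremum has weight 1, and \<open>U t t\<close> is
  the identity.\<close>

lemma norm_le_phi: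
  assumes "evolution_family U" "\<alpha> \<in> admissible_exponents U" "0 \<le> t"
  shows "norm (u t) \<le> phi U \<alpha> t u"
  using phi_upper[of \<alpha> U t t u] assms by (simp add: evolution_family_def)

lemma zero_mem_Cb: "(\<lambda>_. 0) \<in> Cb U \<alpha>"
proof -
  have "phi U \<alpha> t (\<lambda>_. 0) \<le> 0" for t by (rule phi_least) simp
  then show ?thesis by (auto simp: Cb_def C_Rplus_def intro!: bdd_aboveI2)
qed

lemma A_graph_zero_iff:
  "A_graph U \<alpha> \<tau> u (\<lambda>_. 0) \<longleftrightarrow>
    u \<in> Cb U \<alpha> \<and> (\<forall>t s. t \<ge> s \<and> s \<ge> \<tau> \<longrightarrow> u t = blinfun_apply (U t s) (u s))"
  by (auto simp: A_graph_def zero_mem_Cb)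

text \<open>Uniqueness of the graph value turns the \<open>THE\<close> in \<open>A_op\<close> into
  the relation \<open>A_graph\<close> with right-hand side zero, where the integral term
  vanishes.\<close>

lemma mem_A_ker_iff:
  assumes "evolution_family U" "\<alpha> \<in> admissible_exponents U" "0 \<le> \<tau>"
  shows "u \<in> A_ker U \<alpha> \<tau> \<longleftrightarrow>
    u \<in> Cb U \<alpha> \<and> (\<forall>t s. t \<ge> s \<and> s \<ge> \<tau> \<longrightarrow> u t = blinfun_apply (U t s) (u s))"
proof -
  have op: "A_op U \<alpha> \<tau> u = f" if "A_graph U \<alpha> \<tau> u f" for f
    unfolding A_op_def using A_graph_unique[OF assms] that by blast
  have "u \<in> A_ker U \<alpha> \<tau> \<longleftrightarrow> A_graph U \<alpha> \<tau> u (\<lambda>_. 0)"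
    unfolding A_ker_def A_dom_def using op by auto
  then show ?thesis by (simp add: A_graph_zero_iff)
qed

section \<open>Action of \<open>Phi\<close> on \<open>Cb\<close>\<close>

lemma evolution_family_orbit_continuous:
  assumes "evolution_family U" "0 \<le> s"
  shows "continuous_on {s..} (\<lambda>t. blinfun_apply (U t s) x)"
proof -
  have "continuous_on {(t, s). t \<ge> s \<and> s \<ge> 0} (\<lambda>(t, s). blinfun_apply (U t s) x)"
    using assms unfolding evolution_family_def by blast
  then have "continuous_on {s..} ((\<lambda>(t, s). blinfun_apply (U t s) x) \<circ> (\<lambda>t. (t, s)))"
    using assms by (intro continuous_on_compose continuous_intros) (auto elim!: continuous_on_subset)
  then show ?thesis by (simp add: o_def)
qed

lemma Phi_mem_C_Rplus:
  assumes ev: "evolution_family U" and \<tau>: "0 \<le> \<tau>" and u: "u \<in> C_Rplus"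
  shows "Phi U \<tau> u \<in> C_Rplus"
proof -
  have uc: "continuous_on {0..} u" using u by (simp add: C_Rplus_def)
  \<comment> \<open>The two closed pieces meet only in \<open>\<tau>\<close>, where the branches
    agree because \<open>U \<tau> \<tau>\<close> is the identity.\<close>
  have "continuous_on ({\<tau>..} \<union> {0..\<tau>}) (Phi U \<tau> u)"
    unfolding Phi_def
  proof (rule continuous_on_If)
    show "continuous_on {0..\<tau>} u" by (rule continuous_on_subset[OF uc]) auto
  qed (use ev \<tau> evolution_family_orbit_continuous in \<open>auto simp: evolution_family_def\<close>)
  moreover have "{\<tau>..} \<union> {0..\<tau>} = {0..}" using \<tau> by auto
  ultimately show ?thesis using u \<tau> by (simp add: C_Rplus_def Phi_def)
qed

text \<open>For exponent 0 the weight disappears. From any \<open>t \<ge> \<tau>\<close>, the orbit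
  of \<open>Phi U \<tau> u t\<close> is a tail of the orbit of \<open>u \<tau>\<close>, so the bound
  for \<open>u\<close> still works.\<close>

lemma Phi_mem_Cb_stable:
  assumes ev: "evolution_family U" and st: "0 \<in> admissible_exponents U"
    and \<tau>: "0 \<le> \<tau>" and u: "u \<in> Cb U 0"
  shows "Phi U \<tau> u \<in> Cb U 0"
proof -
  obtain B where B: "\<And>t. 0 \<le> t \<Longrightarrow> phi U 0 t u \<le> B"
    using u by (auto simp: Cb_def bdd_above_def)
  have orbit: "norm (blinfun_apply (U r t) (u t)) \<le> B" if "0 \<le> t" "t \<le> r" for r t
    using phi_upper[OF st that, of u] B[OF that(1)] by simp
  have "phi U 0 t (Phi U \<tau> u) \<le> B" if t: "0 \<le> t" for t
  proof (rule phi_least)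
    fix r assume r: "t \<le> r"
    have "norm (blinfun_apply (U r t) (Phi U \<tau> u t)) \<le> B"
    proof (cases "\<tau> \<le> t")
      case True
      then have "U r t o\<^sub>L U t \<tau> = U r \<tau>" using ev r \<tau> by (simp add: evolution_family_def)
      then have "blinfun_apply (U r t) (Phi U \<tau> u t) = blinfun_apply (U r \<tau>) (u \<tau>)"
        using True by (simp add: Phi_def flip: blinfun_apply_blinfun_compose)
      then show ?thesis using orbit[of \<tau> r] True r \<tau> by simp
    next
      case False
      then show ?thesis using orbit[OF t r] by (simp add: Phi_def)
    qed
    then show "exp (- 0 * (r - t)) * norm (blinfun_apply (U r t) (Phi U \<tau> u t)) \<le> B" by simp
  qed
  then show ?thesis
    using Phi_mem_C_Rplus[OF ev \<tau>, of u] u by (auto simp: Cb_def intro!: bdd_aboveI2)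
qed

text \<open>Each kernel element is its own preimage, being a fixed point of
  \<open>Phi U \<tau>\<close>.\<close>

lemma A_ker_subset_range_Phi:
  assumes "evolution_family U" "\<alpha> \<in> admissible_exponents U" "0 \<le> \<tau>"
  shows "A_ker U \<alpha> \<tau> \<subseteq> Phi U \<tau> ` Cb U \<alpha>"
proof
  fix u assume "u \<in> A_ker U \<alpha> \<tau>"
  then have u: "u \<in> Cb U \<alpha>" "\<And>t. t \<ge> \<tau> \<Longrightarrow> u t = blinfun_apply (U t \<tau>) (u \<tau>)"
    using mem_A_ker_iff[OF assms] by auto
  have "Phi U \<tau> u = u"
    by (rule ext) (simp add: Phi_def u(2)[symmetric])
  then show "u \<in> Phi U \<tau> ` Cb U \<alpha>" using u(1) by (metis imageI)
qed

lemma exists_Cb_through: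
  fixes U :: "real \<Rightarrow> real \<Rightarrow> 'a::banach \<Rightarrow>\<^sub>L 'a"
  assumes \<alpha>: "\<alpha> \<in> admissible_exponents U" and \<tau>: "0 \<le> \<tau>"
  obtains u where "u \<in> Cb U \<alpha>" "u \<tau> = x"
proof -
  obtain M where Mc: "continuous_on {0..} M"
    and M: "\<And>t s. \<lbrakk>t \<ge> s; s \<ge> 0\<rbrakk> \<Longrightarrow> norm (U t s) \<le> M s * exp (\<alpha> * (t - s))"
    using \<alpha> unfolding admissible_exponents_def by blast
  \<comment> \<open>A tent with peak \<open>x\<close> at \<open>\<tau>\<close>, set to zero at
    negative times as \<open>C_Rplus\<close> requires. It vanishes after \<open>\<tau> + 1\<close>,
    so only the values of \<open>M\<close> on a compact interval matter.\<close>
  define u where "u t = (if t < 0 then 0 else max 0 (1 - \<bar>t - \<tau>\<bar>) *\<^sub>R x)" for t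
  have uc: "continuous_on {0..} u"
  proof -
    have "continuous_on {0..} (\<lambda>t. max 0 (1 - \<bar>t - \<tau>\<bar>) *\<^sub>R x)" by (intro continuous_intros)
    then show ?thesis by (rule continuous_on_eq) (auto simp: u_def)
  qed
  have "compact ((\<lambda>t. M t * norm (u t)) ` {0..\<tau>+1})"
    by (intro compact_continuous_image continuous_intros continuous_on_subset[OF Mc]
        continuous_on_subset[OF uc]) auto
  then have "bounded ((\<lambda>t. M t * norm (u t)) ` {0..\<tau>+1})" by (rule compact_imp_bounded)
  then obtain B where B: "\<And>t. t \<in> {0..\<tau>+1} \<Longrightarrow> \<bar>M t * norm (u t)\<bar> \<le> B"
    unfolding bounded_iff by fastforce
  have B0: "0 \<le> B" using B[of 0] \<tau> by auto
  have "phi U \<alpha> t u \<le> B" if t: "0 \<le> t" for t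
  proof (rule phi_least)
    fix r assume r: "t \<le> r"
    show "exp (- \<alpha> * (r - t)) * norm (blinfun_apply (U r t) (u t)) \<le> B"
    proof (cases "t \<le> \<tau> + 1")
      case True
      then have "M t * norm (u t) \<le> B" using B[of t] t by auto
      then show ?thesis using weighted_norm_apply_le[OF M[OF r t], of "u t"] by simp
    next
      case False
      then have "u t = 0" by (simp add: u_def)
      then show ?thesis using B0 by simp
    qed
  qed
  then have "u \<in> Cb U \<alpha>"
    using uc by (auto simp: Cb_def C_Rplus_def u_def intro!: bdd_aboveI2)
  moreover have "u \<tau> = x" using \<tau> by (simp add: u_def)
  ultimately show ?thesis by (rule that)
qed

section \<open>The uniform boundedness principle\<close>

text \<open>By Baire category some \<open>V n\<close> misses a ball. On that ball every
  \<open>T i\<close> is bounded by \<open>n\<close>, and linearity carries this bound over to the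
  operator norms.\<close>

theorem uniform_boundedness_blinfun:
  fixes T :: "'i \<Rightarrow> 'a::banach \<Rightarrow>\<^sub>L 'b::real_normed_vector"
  assumes ptw: "\<And>x. \<exists>B. \<forall>i\<in>I. norm (blinfun_apply (T i) x) \<le> B"
  shows "\<exists>K. \<forall>i\<in>I. norm (T i) \<le> K"
proof -
  define V where "V n = (\<Union>i\<in>I. {x. real n < norm (blinfun_apply (T i) x)})" for n
  have V_open: "open (V n)" for n
    unfolding V_def by (intro open_UN ballI open_Collect_less continuous_intros)
  obtain n where n: "closure (V n) \<noteq> UNIV"
  proof (rule ccontr)
    \<comment> \<open>If all the open sets \<open>V n\<close> were dense, they would have a common
      point, and there the family would be unbounded.\<close>
    assume "\<not> thesis"
    then have "\<And>n. closure (V n) = UNIV" using that by blast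
    then have "Met_TC.mtopology closure_of \<Inter> (range V) = (UNIV :: 'a set)"
      using V_open complete_UNIV by (intro Met_TC.metric_Baire_category) auto
    then have "\<Inter> (range V) \<noteq> {}" by force
    then obtain x where "x \<in> \<Inter> (range V)" by blast
    then have x: "\<exists>i\<in>I. real n < norm (blinfun_apply (T i) x)" for n by (auto simp: V_def)
    obtain B where "\<forall>i\<in>I. norm (blinfun_apply (T i) x) \<le> B" using ptw by blast
    moreover obtain m where "B \<le> real m" using real_arch_simple by blast
    ultimately show False using x[of m] by force
  qed
  then obtain x where "x \<in> - closure (V n)" by auto
  moreover have "open (- closure (V n))" by (simp add: open_Compl)
  ultimately obtain e where e: "e > 0" "cball x e \<subseteq> - closure (V n)"
    by (meson open_contains_cball)
  have le: "norm (blinfun_apply (T i) y) \<le> n" if "i \<in> I" "y \<in> cball x e" for i y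
  proof -
    have "y \<notin> V n" using e(2) that(2) closure_subset by blast
    then show ?thesis using that(1) by (force simp: V_def)
  qed
  have "norm (T i) \<le> 2 * n / e" if i: "i \<in> I" for i
  proof (rule norm_blinfun_bound)
    fix y
    show "norm (blinfun_apply (T i) y) \<le> 2 * n / e * norm y"
    proof (cases "y = 0")
      case False
      \<comment> \<open>Rescaling \<open>y\<close> to length \<open>e\<close> keeps
        \<open>x + z\<close> in the ball; as \<open>z\<close> is the difference of
        \<open>x + z\<close> and \<open>x\<close>, the bound becomes \<open>2 * n\<close>.\<close>
      define z where "z = (e / norm y) *\<^sub>R y"
      have "norm z = e" using False e(1) by (simp add: z_def)
      then have "x + z \<in> cball x e" "x \<in> cball x e" using e(1) by (auto simp: dist_norm)
      then have "norm (blinfun_apply (T i) (x + z)) \<le> n" "norm (blinfun_apply (T i) x) \<le> n"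
        using le i by blast+
      then have "norm (blinfun_apply (T i) (x + z) - blinfun_apply (T i) x) \<le> 2 * n"
        using norm_triangle_ineq4[of "blinfun_apply (T i) (x + z)" "blinfun_apply (T i) x"] by linarith
      then have "norm (blinfun_apply (T i) z) \<le> 2 * n" by (simp add: blinfun.add_right)
      then have "e / norm y * norm (blinfun_apply (T i) y) \<le> 2 * n"
        using e(1) by (simp add: z_def blinfun.scaleR_right)
      then show ?thesis using e(1) False by (simp add: field_simps)
    qed simp
  qed (use e(1) in simp)
  then show ?thesis by blast
qed

section \<open>From bounded orbits to a continuous stability bound\<close>

text \<open>The integral of \<open>g\<close> over \<open>{s..s+1}\<close> dominates
  \<open>g s\<close> by monotonicity. Starting at 0 instead only enlarges it, since \<open>g\<close>
  is nonnegative, and makes \<open>N\<close> a shifted indefinite integral.\<close>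

lemma mono_continuous_majorant:
  fixes g :: "real \<Rightarrow> real"
  assumes g: "mono g" and g0: "\<And>x. 0 \<le> g x"
  obtains N where "continuous_on {0..} N" "\<And>s. 0 \<le> s \<Longrightarrow> g s \<le> N s"
proof
  define N where "N s = integral {0..s+1} g" for s
  have int: "g integrable_on {a..b}" for a b
    using g by (intro integrable_on_mono_on) (auto simp: mono_on_def mono_def)
  have cont: "continuous_on {0..b} N" for b
  proof -
    have "continuous_on {0..b} ((\<lambda>s. integral {0..s} g) \<circ> (\<lambda>s. s + 1))"
      by (intro continuous_on_compose continuous_intros
          continuous_on_subset[OF indefinite_integral_continuous_1[OF int, of 0 "b+1"]]) auto
    then show ?thesis by (simp add: o_def N_def)
  qed
  show "continuous_on {0..} N"
    unfolding continuous_on_eq_continuous_within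
  proof
    fix s :: real assume s: "s \<in> {0..}"
    have "continuous (at s within {0..s+1}) N"
      using cont[of "s+1"] s by (simp add: continuous_on_eq_continuous_within)
    \<comment> \<open>Continuity is local, so compact intervals suffice to cover the
      half-line.\<close>
    moreover have "at s within {0..s+1} = at s within {0..}"
      by (rule at_within_nhd[of _ "{..<s+1}"]) auto
    ultimately show "continuous (at s within {0..}) N" by simp
  qed
  show "g s \<le> N s" if s: "0 \<le> s" for s
  proof -
    have "g s = integral {s..s+1} (\<lambda>_. g s)" by simp
    also have "\<dots> \<le> integral {s..s+1} g"
      by (intro integral_le int) (use g in \<open>auto simp: mono_def\<close>)
    also have "\<dots> \<le> integral {0..s+1} g"
      by (intro integral_subset_le int) (use s g0 in auto)
    finally show ?thesis by (simp add: N_def)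
  qed
qed

text \<open>A bound at time \<open>n + 1\<close> bounds all initial times in \<open>[n, n + 1]\<close>, because
  \<open>U t s = U t (n + 1) U (n + 1) s\<close>.\<close>

lemma nonuniformly_stable_if_bounded_orbits:
  fixes U :: "real \<Rightarrow> real \<Rightarrow> 'a::banach \<Rightarrow>\<^sub>L 'a"
  assumes ev: "evolution_family U" and \<alpha>: "\<alpha> \<in> admissible_exponents U" and \<alpha>0: "0 \<le> \<alpha>"
    and orbits: "\<And>s x. 0 \<le> s \<Longrightarrow> \<exists>B. \<forall>t\<ge>s. norm (blinfun_apply (U t s) x) \<le> B"
  shows "nonuniformly_stable U"
proof -
  obtain M where Mc: "continuous_on {0..} M" and Mpos: "\<And>s. 0 \<le> s \<Longrightarrow> 0 < M s"
    and M: "\<And>t s. \<lbrakk>t \<ge> s; s \<ge> 0\<rbrakk> \<Longrightarrow> norm (U t s) \<le> M s * exp (\<alpha> * (t - s))"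
    using \<alpha> unfolding admissible_exponents_def by blast
  have "\<exists>K. \<forall>t\<in>{real n..}. norm (U t (real n)) \<le> K" for n
    using orbits[of "real n"] by (intro uniform_boundedness_blinfun) (simp add: Ball_def)
  then have "\<exists>K. \<forall>n. \<forall>t\<in>{real n..}. norm (U t (real n)) \<le> K n" by (intro choice allI)
  then obtain K where K: "\<And>n t. real n \<le> t \<Longrightarrow> norm (U t (real n)) \<le> K n" by auto
  have K0: "0 \<le> K n" for n using order_trans[OF norm_ge_zero K[of n "real n"]] by simp
  \<comment> \<open>Partial sums of the nonnegative \<open>K\<close> are monotone and reach the
    index of the first integer after \<open>s\<close>. The summand 1 gives
    \<open>g s \<ge> 1\<close>, used before that integer and for positivity of the final
    bound.\<close>
  define g where "g s = 1 + (\<Sum>k\<le>nat \<lfloor>s\<rfloor> + 1. K k)" for s :: real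
  have "mono g"
    unfolding g_def by (intro monoI add_left_mono sum_mono2) (auto simp: K0 nat_mono floor_mono)
  moreover have g1: "1 \<le> g s" for s by (simp add: g_def sum_nonneg K0)
  ultimately obtain N where Nc: "continuous_on {0..} N" and N: "\<And>s. 0 \<le> s \<Longrightarrow> g s \<le> N s"
    using mono_continuous_majorant[of g] order_trans[OF zero_le_one g1] by blast
  have bound: "norm (U t s) \<le> N s * (M s * exp \<alpha>)" if s: "0 \<le> s" and t: "s \<le> t" for t s
  proof -
    define n where "n = nat \<lfloor>s\<rfloor> + 1"
    have n: "s \<le> real n" "real n \<le> s + 1" using s by (auto simp: n_def; linarith)+
    \<comment> \<open>Over at most one unit of time, \<open>\<alpha> \<ge> 0\<close> bounds the
      exponential growth by \<open>exp \<alpha>\<close>.\<close>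
    have short: "norm (U r s) \<le> M s * exp \<alpha>" if "s \<le> r" "r \<le> s + 1" for r
    proof -
      have "\<alpha> * (r - s) \<le> \<alpha> * 1" using that \<alpha>0 by (intro mult_left_mono) auto
      then have "M s * exp (\<alpha> * (r - s)) \<le> M s * exp \<alpha>"
        using Mpos[OF s] by (intro mult_left_mono) auto
      then show ?thesis using M[OF that(1) s] by linarith
    qed
    have pos: "0 \<le> M s * exp \<alpha>" using Mpos[OF s] by simp
    have "norm (U t s) \<le> g s * (M s * exp \<alpha>)"
    \<comment> \<open>Up to time \<open>n\<close> the short-time bound is enough; later the
      evolution factors through \<open>n\<close>, where \<open>K n\<close> takes over.\<close>
    proof (cases "t \<le> real n")
      case True
      then have "norm (U t s) \<le> 1 * (M s * exp \<alpha>)" using short[of t] t n by simp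
      also have "\<dots> \<le> g s * (M s * exp \<alpha>)" by (intro mult_right_mono g1 pos)
      finally show ?thesis .
    next
      case False
      have "K n \<le> (\<Sum>k\<le>n. K k)" by (rule member_le_sum) (auto simp: K0)
      then have Kg: "K n \<le> g s" by (simp add: g_def n_def)
      have "U t s = U t (real n) o\<^sub>L U (real n) s"
        using ev False n s by (simp add: evolution_family_def)
      then have "norm (U t s) \<le> norm (U t (real n)) * norm (U (real n) s)"
        by (simp add: norm_blinfun_compose)
      also have "\<dots> \<le> g s * (M s * exp \<alpha>)"
        using K[of n t] Kg False short[of "real n"] n g1[of s] by (intro mult_mono) auto
      finally show ?thesis .
    qed
    also have "\<dots> \<le> N s * (M s * exp \<alpha>)" by (intro mult_right_mono N s pos)
    finally show ?thesis .
  qed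
  have "continuous_on {0..} (\<lambda>s. N s * (M s * exp \<alpha>))"
    by (intro continuous_intros Nc Mc)
  moreover have "0 < N s * (M s * exp \<alpha>)" if "0 \<le> s" for s
    using Mpos[OF that] N[OF that] g1[of s] by (intro mult_pos_pos) auto
  ultimately show ?thesis
    using bound unfolding nonuniformly_stable_def admissible_exponents_def mem_Collect_eq
    by (intro exI[of _ "\<lambda>s. N s * (M s * exp \<alpha>)"]) simp
qed

text \<open>The exponential factor is at most 1, so the same \<open>M\<close> serves for exponent
  0.\<close>

lemma nonuniformly_stable_if_nonpos:
  assumes "\<alpha> \<in> admissible_exponents U" "\<alpha> \<le> 0"
  shows "nonuniformly_stable U"
proof -
  obtain M where Mc: "continuous_on {0..} M" and Mpos: "\<forall>s\<ge>0. 0 < M s"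
    and M: "\<And>t s. \<lbrakk>t \<ge> s; s \<ge> 0\<rbrakk> \<Longrightarrow> norm (U t s) \<le> M s * exp (\<alpha> * (t - s))"
    using assms unfolding admissible_exponents_def by blast
  have "norm (U t s) \<le> M s" if "s \<ge> 0" "t \<ge> s" for t s
  proof -
    have "\<alpha> * (t - s) \<le> 0" using assms that by (simp add: mult_le_0_iff)
    then have "M s * exp (\<alpha> * (t - s)) \<le> M s * 1"
      using Mpos that by (intro mult_left_mono) (auto simp: less_imp_le)
    then show ?thesis using M[OF that(2,1)] by simp
  qed
  then show ?thesis
    using Mc Mpos unfolding nonuniformly_stable_def admissible_exponents_def mem_Collect_eq
    by (intro exI[of _ M]) simp
qed

section \<open>The kernel condition and stability\<close>

text \<open>After time \<open>s\<close>, \<open>Phi U s u\<close> is the orbit of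
  \<open>x = u s\<close>. Membership in \<open>Cb\<close> bounds its values uniformly in time
  without an exponential weight, because \<open>phi\<close> dominates the norm at its own starting
  time.\<close>

lemma bounded_orbits_if_Phi_invariant:
  fixes U :: "real \<Rightarrow> real \<Rightarrow> 'a::banach \<Rightarrow>\<^sub>L 'a"
  assumes ev: "evolution_family U" and \<alpha>: "\<alpha> \<in> admissible_exponents U" and s: "0 \<le> s"
    and inv: "Phi U s ` Cb U \<alpha> \<subseteq> Cb U \<alpha>"
  shows "\<exists>B. \<forall>t\<ge>s. norm (blinfun_apply (U t s) x) \<le> B"
proof -
  obtain u where u: "u \<in> Cb U \<alpha>" "u s = x" using exists_Cb_through[OF \<alpha> s] .
  then have "Phi U s u \<in> Cb U \<alpha>" using inv by auto
  then obtain B where B: "\<And>t. 0 \<le> t \<Longrightarrow> phi U \<alpha> t (Phi U s u) \<le> B"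
    by (auto simp: Cb_def bdd_above_def)
  have "norm (blinfun_apply (U t s) x) \<le> B" if "t \<ge> s" for t
    using norm_le_phi[OF ev \<alpha>, of t "Phi U s u"] B[of t] that s u(2) by (simp add: Phi_def)
  then show ?thesis by blast
qed

theorem corollary3p4:
  fixes U :: "real \<Rightarrow> real \<Rightarrow> 'a::banach \<Rightarrow>\<^sub>L 'a"
  assumes "evolution_family U"
    and "nonuniform_exponentially_bounded U"
  shows "nonuniformly_stable U \<longleftrightarrow>
    (\<exists>\<alpha>\<in>admissible_exponents U. \<forall>\<tau>\<ge>0. A_ker U \<alpha> \<tau> = Phi U \<tau> ` Cb U \<alpha>)"
proof
  assume "nonuniformly_stable U"
  then have st: "0 \<in> admissible_exponents U" by (simp add: nonuniformly_stable_def)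
  have "Phi U \<tau> u \<in> A_ker U 0 \<tau>" if \<tau>: "0 \<le> \<tau>" and u: "u \<in> Cb U 0" for \<tau> u
  proof -
    have "Phi U \<tau> u t = blinfun_apply (U t s) (Phi U \<tau> u s)" if "t \<ge> s" "s \<ge> \<tau>" for t s
    proof -
      have "U t \<tau> = U t s o\<^sub>L U s \<tau>"
        using assms(1) that \<tau> by (simp add: evolution_family_def)
      then show ?thesis using that by (simp add: Phi_def)
    qed
    then show ?thesis
      using Phi_mem_Cb_stable[OF assms(1) st \<tau> u] mem_A_ker_iff[OF assms(1) st \<tau>] by blast
  qed
  then have "A_ker U 0 \<tau> = Phi U \<tau> ` Cb U 0" if "0 \<le> \<tau>" for \<tau>
    using A_ker_subset_range_Phi[OF assms(1) st that] that by blast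
  then show "\<exists>\<alpha>\<in>admissible_exponents U. \<forall>\<tau>\<ge>0. A_ker U \<alpha> \<tau> = Phi U \<tau> ` Cb U \<alpha>"
    using st by blast
next
  assume "\<exists>\<alpha>\<in>admissible_exponents U. \<forall>\<tau>\<ge>0. A_ker U \<alpha> \<tau> = Phi U \<tau> ` Cb U \<alpha>"
  then obtain \<alpha> where \<alpha>: "\<alpha> \<in> admissible_exponents U"
    and ker: "\<And>\<tau>. 0 \<le> \<tau> \<Longrightarrow> A_ker U \<alpha> \<tau> = Phi U \<tau> ` Cb U \<alpha>" by blast
  \<comment> \<open>Of the kernel equality only this consequence is kept: kernel elements lie in
    \<open>Cb U \<alpha>\<close>.\<close>
  have "Phi U \<tau> ` Cb U \<alpha> \<subseteq> Cb U \<alpha>" if "0 \<le> \<tau>" for \<tau>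
    using ker[OF that] mem_A_ker_iff[OF assms(1) \<alpha> that] by blast
  then have "\<exists>B. \<forall>t\<ge>s. norm (blinfun_apply (U t s) x) \<le> B" if "0 \<le> s" for s x
    using bounded_orbits_if_Phi_invariant[OF assms(1) \<alpha> that] that by blast
  then show "nonuniformly_stable U"
    using nonuniformly_stable_if_bounded_orbits[OF assms(1) \<alpha>]
      nonuniformly_stable_if_nonpos[OF \<alpha>] by (cases "0 \<le> \<alpha>") auto
qed

end
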